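(* Let $G\subset\mathbb{R}^3$ be a bounded open set whose boundary $\Gamma$ is a Lipschitz surface, and let $G'=\mathbb{R}^3\setminus\overline{G}$. Then the spaces $H^1_{\Gamma,\Delta=0}$ and $K^1_{\Gamma,\Delta=0}$ are orthogonal with respect to the scalar product $(u,v)\mapsto\int_{G\cup G'}\nabla u\cdot\nabla v$; that is, $$\int_{G\cup G'}\nabla u\cdot\nabla v\,dx=0\qquad\text{for all } u\in H^1_{\Gamma,\Delta=0},\ v\in K^1_{\Gamma,\Delta=0}.$$
   Context: All functions are real-valued. $W_2^1(G)$ is the usual Sobolev space; $W^1_{2,0}(G')=\{u^e\in D'(G'): u^e/r\in L_2(G'),\ Du^e\in L_2(G')\}$ with $r=|x|$. $H^1=W_2^1(G)\times W^1_{2,0}(G')$, with elements $u=(u^i,u^e)$, and $H^1_{\Delta=0}$ is the subspace of those $u$ with $\Delta u^i=0$ in $G$ and $\Delta u^e=0$ in $G'$ (in the distributional sense). $W_2^{1/2}(\Gamma)$ is the trace space and $W_2^{-1/2}(\Gamma)$ its dual. $\gamma_0^i:W_2^1(G)\to W_2^{1/2}(\Gamma)$ and $\gamma_0^e:W_{2,0}^1(G')\to W_2^{1/2}(\Gamma)$ are the trace operators. $\mathbf n$ is the unit normal on $\Gamma$ pointing out of $G$. For $u\in H^1_{\Delta=0}$ the normal derivatives $\gamma_1^iu^i=\partial u^i/\partial\mathbf n$ and $\gamma_1^eu^e=\partial u^e/\partial\mathbf n$ (from the inside and from the outside) are the elements of $W_2^{-1/2}(\Gamma)$ determined by $\int_G\nabla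 u^i\cdot\nabla v^i=\langle\gamma_1^iu^i,\gamma_0^iv^i\rangle$ for all $v^i\in W_2^1(G)$ and $\int_{G'}\nabla u^e\cdot\nabla v^e=-\langle\gamma_1^eu^e,\gamma_0^ev^e\rangle$ for all $v^e\in W_{2,0}^1(G')$. Jumps: $\gamma_0^1u=\gamma_0^iu^i-\gamma_0^eu^e$, $\gamma_1^1u=\gamma_1^iu^i-\gamma_1^eu^e$. $R$ is the space of functions that are constant on $G$ and zero on $G'$. $H^1_{\Gamma,\Delta=0}=\{u\in H^1_{\Delta=0}:\gamma_0^1u=0\}$. $K^1_{\Gamma,\Delta=0}=\{u\in H^1_{\Delta=0}:\gamma_1^1u=0\}/R$ (classes modulo $R$; the integral in the claim does not depend on the representative of $v$). *)

theory Defs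
  imports "HOL-Analysis.Analysis"
begin

type_synonym R3 = "real ^ 3"

text \<open>Functions on an open set are represented by total functions whose values outside that set
  are irrelevant. Elements of \<open>L\<^sub>2\<close> and of the Sobolev spaces are represented by functions,
  not by classes modulo null sets.\<close>

section \<open>Lipschitz domains\<close>

definition exterior :: "R3 set \<Rightarrow> R3 set" where
  "exterior G = - closure G"

text \<open>Near each boundary point, in suitable Cartesian coordinates, \<open>G\<close> is the part of space
  strictly below the graph of a Lipschitz function. Hence the boundary is locally that graph,
  and \<open>G\<close> lies on one side of it only, so that inside and outside are defined.\<close>

definition lipschitz_boundary :: "R3 set \<Rightarrow> bool" where
  "lipschitz_boundary G \<longleftrightarrow>
     (\<forall>p \<in> frontier G. \<exists>(T :: R3 \<Rightarrow> R3) (\<psi> :: real \<times> real \<Rightarrow> real) L e.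
        orthogonal_transformation T \<and> L-lipschitz_on UNIV \<psi> \<and> e > 0 \<and>
        (\<forall>x \<in> ball p e. x \<in> G \<longleftrightarrow> T x $ 3 < \<psi> (T x $ 1, T x $ 2)))"


section \<open>Test functions and weak derivatives\<close>

definition partial_deriv :: "3 \<Rightarrow> (R3 \<Rightarrow> real) \<Rightarrow> R3 \<Rightarrow> real" where
  "partial_deriv i f x = frechet_derivative f (at x) (axis i 1)"

primrec C_k :: "nat \<Rightarrow> (R3 \<Rightarrow> real) \<Rightarrow> bool" where
  "C_k 0 f \<longleftrightarrow> continuous_on UNIV f"
| "C_k (Suc k) f \<longleftrightarrow> (\<forall>x. f differentiable at x) \<and> (\<forall>i. C_k k (partial_deriv i f))"

definition test_functions :: "R3 set \<Rightarrow> (R3 \<Rightarrow> real) set" where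
  "test_functions \<Omega> =
     {\<phi>. (\<forall>k. C_k k \<phi>) \<and> compact (closure {x. \<phi> x \<noteq> 0}) \<and> closure {x. \<phi> x \<noteq> 0} \<subseteq> \<Omega>}"

definition laplacian :: "(R3 \<Rightarrow> real) \<Rightarrow> R3 \<Rightarrow> real" where
  "laplacian \<phi> x = (\<Sum>i\<in>UNIV. partial_deriv i (partial_deriv i \<phi>) x)"

definition locally_integrable :: "R3 set \<Rightarrow> (R3 \<Rightarrow> 'b::euclidean_space) \<Rightarrow> bool" where
  "locally_integrable \<Omega> f \<longleftrightarrow> (\<forall>C. compact C \<and> C \<subseteq> \<Omega> \<longrightarrow> set_integrable lebesgue C f)"

definition has_weak_grad :: "R3 set \<Rightarrow> (R3 \<Rightarrow> real) \<Rightarrow> (R3 \<Rightarrow> R3) \<Rightarrow> bool" where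
  "has_weak_grad \<Omega> u D \<longleftrightarrow>
     locally_integrable \<Omega> u \<and> locally_integrable \<Omega> D \<and>
     (\<forall>\<phi> \<in> test_functions \<Omega>. \<forall>i.
        (LINT x:\<Omega>|lebesgue. u x * partial_deriv i \<phi> x) = - (LINT x:\<Omega>|lebesgue. D x $ i * \<phi> x))"

text \<open>The weak gradient is unique only up to a null set; some representative is chosen.\<close>

definition weak_grad :: "R3 set \<Rightarrow> (R3 \<Rightarrow> real) \<Rightarrow> R3 \<Rightarrow> R3" where
  "weak_grad \<Omega> u = (SOME D. has_weak_grad \<Omega> u D)"

definition weakly_differentiable :: "R3 set \<Rightarrow> (R3 \<Rightarrow> real) \<Rightarrow> bool" where
  "weakly_differentiable \<Omega> u \<longleftrightarrow> (\<exists>D. has_weak_grad \<Omega> u D)"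

definition weakly_harmonic :: "R3 set \<Rightarrow> (R3 \<Rightarrow> real) \<Rightarrow> bool" where
  "weakly_harmonic \<Omega> u \<longleftrightarrow>
     (\<forall>\<phi> \<in> test_functions \<Omega>. (LINT x:\<Omega>|lebesgue. u x * laplacian \<phi> x) = 0)"


section \<open>Sobolev spaces\<close>

definition L2 :: "R3 set \<Rightarrow> (R3 \<Rightarrow> 'b::euclidean_space) set" where
  "L2 \<Omega> = {f. set_borel_measurable lebesgue \<Omega> f \<and>
              set_integrable lebesgue \<Omega> (\<lambda>x. (norm (f x))\<^sup>2)}"

definition W21 :: "R3 set \<Rightarrow> (R3 \<Rightarrow> real) set" where
  "W21 \<Omega> = {u. u \<in> L2 \<Omega> \<and> weakly_differentiable \<Omega> u \<and> weak_grad \<Omega> u \<in> L2 \<Omega>}"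

definition W21_norm :: "R3 set \<Rightarrow> (R3 \<Rightarrow> real) \<Rightarrow> real" where
  "W21_norm \<Omega> u =
     sqrt ((LINT x:\<Omega>|lebesgue. (u x)\<^sup>2) + (LINT x:\<Omega>|lebesgue. (norm (weak_grad \<Omega> u x))\<^sup>2))"

definition W210 :: "R3 set \<Rightarrow> (R3 \<Rightarrow> real) set" where
  "W210 \<Omega> = {u. (\<lambda>x. u x / norm x) \<in> L2 \<Omega> \<and> weakly_differentiable \<Omega> u \<and> weak_grad \<Omega> u \<in> L2 \<Omega>}"

definition W210_norm :: "R3 set \<Rightarrow> (R3 \<Rightarrow> real) \<Rightarrow> real" where
  "W210_norm \<Omega> u =
     sqrt ((LINT x:\<Omega>|lebesgue. (u x / norm x)\<^sup>2) + (LINT x:\<Omega>|lebesgue. (norm (weak_grad \<Omega> u x))\<^sup>2))"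


section \<open>The trace space and its dual\<close>

text \<open>Surface area is two-dimensional Hausdorff measure, normalised by the area \<open>pi / 4\<close> of a
  disc of diameter 1. The covering sets are required to be bounded because \<open>diameter\<close> has no
  meaningful value on unbounded sets.\<close>

definition hausdorff2 :: "R3 set \<Rightarrow> ennreal" where
  "hausdorff2 A =
     (SUP \<delta> \<in> {0<..}.
        INF C \<in> {C :: nat \<Rightarrow> R3 set. A \<subseteq> (\<Union>n. C n) \<and> (\<forall>n. bounded (C n) \<and> diameter (C n) \<le> \<delta>)}.
          (\<Sum>n. ennreal (pi / 4 * (diameter (C n))\<^sup>2)))"

definition surface_measure :: "R3 set \<Rightarrow> R3 measure" where
  "surface_measure \<Gamma> = restrict_space (measure_of UNIV (sets borel) hausdorff2) \<Gamma>"

text \<open>The square of the Sobolev-Slobodeckij norm of order 1/2 on a surface: the exponent is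
  \<open>dim \<Gamma> + 2 * (1/2) = 3\<close>.\<close>

definition half_norm_sq :: "R3 set \<Rightarrow> (R3 \<Rightarrow> real) \<Rightarrow> ennreal" where
  "half_norm_sq \<Gamma> g =
     (\<integral>\<^sup>+x. ennreal ((g x)\<^sup>2) \<partial>surface_measure \<Gamma>) +
     (\<integral>\<^sup>+x. (\<integral>\<^sup>+y. ennreal ((g x - g y)\<^sup>2 / dist x y ^ 3) \<partial>surface_measure \<Gamma>) \<partial>surface_measure \<Gamma>)"

definition W_half :: "R3 set \<Rightarrow> (R3 \<Rightarrow> real) set" where
  "W_half \<Gamma> = {g. g \<in> borel_measurable (surface_measure \<Gamma>) \<and> half_norm_sq \<Gamma> g < \<infinity>}"

text \<open>Continuous linear functionals. Boundedness and linearity make them insensitive to changes of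
  the argument on null sets.\<close>

definition W_half_dual :: "R3 set \<Rightarrow> ((R3 \<Rightarrow> real) \<Rightarrow> real) set" where
  "W_half_dual \<Gamma> =
     {f. (\<forall>g \<in> W_half \<Gamma>. \<forall>h \<in> W_half \<Gamma>. f (\<lambda>x. g x + h x) = f g + f h) \<and>
         (\<forall>g \<in> W_half \<Gamma>. \<forall>c. f (\<lambda>x. c * g x) = c * f g) \<and>
         (\<exists>B. \<forall>g \<in> W_half \<Gamma>. \<bar>f g\<bar> \<le> B * sqrt (enn2real (half_norm_sq \<Gamma> g)))}"


section \<open>Traces and normal derivatives\<close>

text \<open>Like \<open>has_derivative\<close>, the trace and normal derivative operators are given by their graphs.
  The trace operators are the continuous extensions of the restriction to \<open>\<Gamma>\<close> of smooth
  functions on the whole space, which are dense in both Sobolev spaces.\<close>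

definition limit_of_restrictions ::
    "((R3 \<Rightarrow> real) \<Rightarrow> real) \<Rightarrow> R3 set \<Rightarrow> (R3 \<Rightarrow> real) \<Rightarrow> (R3 \<Rightarrow> real) \<Rightarrow> bool" where
  "limit_of_restrictions N \<Gamma> u g \<longleftrightarrow>
     (\<exists>\<phi> :: nat \<Rightarrow> R3 \<Rightarrow> real. (\<forall>n. \<phi> n \<in> test_functions UNIV) \<and>
        (\<lambda>n. N (\<lambda>x. \<phi> n x - u x)) \<longlonglongrightarrow> 0 \<and>
        (\<lambda>n. half_norm_sq \<Gamma> (\<lambda>x. \<phi> n x - g x)) \<longlonglongrightarrow> 0)"

definition has_trace_i :: "R3 set \<Rightarrow> (R3 \<Rightarrow> real) \<Rightarrow> (R3 \<Rightarrow> real) \<Rightarrow> bool" where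
  "has_trace_i G u g \<longleftrightarrow>
     u \<in> W21 G \<and> g \<in> W_half (frontier G) \<and>
     limit_of_restrictions (W21_norm G) (frontier G) u g"

definition has_trace_e :: "R3 set \<Rightarrow> (R3 \<Rightarrow> real) \<Rightarrow> (R3 \<Rightarrow> real) \<Rightarrow> bool" where
  "has_trace_e G u g \<longleftrightarrow>
     u \<in> W210 (exterior G) \<and> g \<in> W_half (frontier G) \<and>
     limit_of_restrictions (W210_norm (exterior G)) (frontier G) u g"

text \<open>The sign in the exterior formula is due to the normal pointing out of \<open>G\<close>, on both sides.\<close>

definition has_normal_deriv_i :: "R3 set \<Rightarrow> (R3 \<Rightarrow> real) \<Rightarrow> ((R3 \<Rightarrow> real) \<Rightarrow> real) \<Rightarrow> bool" where
  "has_normal_deriv_i G u f \<longleftrightarrow>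
     f \<in> W_half_dual (frontier G) \<and>
     (\<forall>w \<in> W21 G. \<forall>g. has_trace_i G w g \<longrightarrow>
        (LINT x:G|lebesgue. weak_grad G u x \<bullet> weak_grad G w x) = f g)"

definition has_normal_deriv_e :: "R3 set \<Rightarrow> (R3 \<Rightarrow> real) \<Rightarrow> ((R3 \<Rightarrow> real) \<Rightarrow> real) \<Rightarrow> bool" where
  "has_normal_deriv_e G u f \<longleftrightarrow>
     f \<in> W_half_dual (frontier G) \<and>
     (\<forall>w \<in> W210 (exterior G). \<forall>g. has_trace_e G w g \<longrightarrow>
        (LINT x:exterior G|lebesgue. weak_grad (exterior G) u x \<bullet> weak_grad (exterior G) w x) = - f g)"

text \<open>Pairs \<open>(u\<^sup>i, u\<^sup>e)\<close> of an interior and an exterior function.\<close>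

type_synonym fun_pair = "(R3 \<Rightarrow> real) \<times> (R3 \<Rightarrow> real)"

definition has_trace_jump :: "R3 set \<Rightarrow> fun_pair \<Rightarrow> (R3 \<Rightarrow> real) \<Rightarrow> bool" where
  "has_trace_jump G u j \<longleftrightarrow>
     (\<exists>g h. has_trace_i G (fst u) g \<and> has_trace_e G (snd u) h \<and>
        (AE x in surface_measure (frontier G). j x = g x - h x))"

definition has_normal_jump :: "R3 set \<Rightarrow> fun_pair \<Rightarrow> ((R3 \<Rightarrow> real) \<Rightarrow> real) \<Rightarrow> bool" where
  "has_normal_jump G u l \<longleftrightarrow>
     (\<exists>f h. has_normal_deriv_i G (fst u) f \<and> has_normal_deriv_e G (snd u) h \<and>
        (\<forall>g \<in> W_half (frontier G). l g = f g - h g))"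


section \<open>The spaces of the decomposition\<close>

definition H1 :: "R3 set \<Rightarrow> fun_pair set" where
  "H1 G = W21 G \<times> W210 (exterior G)"

definition H1_harmonic :: "R3 set \<Rightarrow> fun_pair set" where
  "H1_harmonic G = {u \<in> H1 G. weakly_harmonic G (fst u) \<and> weakly_harmonic (exterior G) (snd u)}"

definition R_space :: "R3 set \<Rightarrow> fun_pair set" where
  "R_space G = {u. (\<exists>c. AE x in lebesgue. x \<in> G \<longrightarrow> fst u x = c) \<and>
                   (AE x in lebesgue. x \<in> exterior G \<longrightarrow> snd u x = 0)}"

definition H1_Gamma_harmonic :: "R3 set \<Rightarrow> fun_pair set" where
  "H1_Gamma_harmonic G = {u \<in> H1_harmonic G. has_trace_jump G u (\<lambda>_. 0)}"

definition zero_normal_jump :: "R3 set \<Rightarrow> fun_pair set" where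
  "zero_normal_jump G = {u \<in> H1_harmonic G. has_normal_jump G u (\<lambda>_. 0)}"

definition mod_R :: "R3 set \<Rightarrow> (fun_pair \<times> fun_pair) set" where
  "mod_R G = {(u, v). u \<in> zero_normal_jump G \<and> v \<in> zero_normal_jump G \<and>
                      (\<lambda>x. fst u x - fst v x, \<lambda>x. snd u x - snd v x) \<in> R_space G}"

definition K1_Gamma_harmonic :: "R3 set \<Rightarrow> fun_pair set set" where
  "K1_Gamma_harmonic G = zero_normal_jump G // mod_R G"

definition grad :: "R3 set \<Rightarrow> fun_pair \<Rightarrow> R3 \<Rightarrow> R3" where
  "grad G u x = (if x \<in> G then weak_grad G (fst u) x else weak_grad (exterior G) (snd u) x)"

definition dirichlet_product :: "R3 set \<Rightarrow> fun_pair \<Rightarrow> fun_pair \<Rightarrow> real" where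
  "dirichlet_product G u v = (LINT x:G \<union> exterior G|lebesgue. grad G u x \<bullet> grad G v x)"

end

theory Submission
  imports Defs
begin

text \<open>The proof is the divergence theorem in its weak form. Let \<open>u\<close> have zero trace jump and \<open>v\<close>
  zero normal jump. The defining identities of the normal derivatives of \<open>v\<close>, with the two
  components of \<open>u\<close> as test functions, turn the Dirichlet integrals of \<open>u\<close> and \<open>v\<close> over \<open>G\<close> and
  over the exterior into \<open>f g\<close> and \<open>- f h\<close>, where \<open>f\<close> is the normal derivative that the two sides of
  \<open>v\<close> share and \<open>g\<close>, \<open>h\<close> are the interior and exterior traces of \<open>u\<close>. As \<open>g\<close> and \<open>h\<close> are equal
  almost everywhere on the boundary, the two contributions cancel.

  Since traces are functions rather than classes, the cancellation needs that functionals of the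
  dual trace space do not see null sets (\<open>W_half_dual_cong_AE\<close>), and splitting the integral over
  the two sides needs that products of square integrable gradients are integrable
  (\<open>L2_inner_set_integrable\<close>).\<close>

lemma L2_inner_set_integrable:
  fixes f g :: "R3 \<Rightarrow> 'b::euclidean_space"
  assumes "f \<in> L2 \<Omega>" "g \<in> L2 \<Omega>"
  shows "set_integrable lebesgue \<Omega> (\<lambda>x. f x \<bullet> g x)"
proof -
  let ?f = "\<lambda>x. indicat_real \<Omega> x *\<^sub>R f x" and ?g = "\<lambda>x. indicat_real \<Omega> x *\<^sub>R g x"
  have meas: "?f \<in> borel_measurable lebesgue" "?g \<in> borel_measurable lebesgue"
    using assms by (auto simp: L2_def set_borel_measurable_def)
  have prod: "indicat_real \<Omega> x *\<^sub>R (f x \<bullet> g x) = ?f x \<bullet> ?g x" for x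
    by (simp add: indicator_def)
  have sq: "integrable lebesgue (\<lambda>x. indicat_real \<Omega> x *\<^sub>R (norm (f x))\<^sup>2 +
              indicat_real \<Omega> x *\<^sub>R (norm (g x))\<^sup>2)"
    using assms by (intro Bochner_Integration.integrable_add)
      (auto simp: L2_def set_integrable_def)
  have young: "\<bar>f x \<bullet> g x\<bar> \<le> (norm (f x))\<^sup>2 + (norm (g x))\<^sup>2" for x
  proof -
    have "2 * (norm (f x) * norm (g x)) \<le> (norm (f x))\<^sup>2 + (norm (g x))\<^sup>2"
      using sum_squares_bound[of "norm (f x)" "norm (g x)"] by (simp add: mult.assoc)
    moreover have "0 \<le> norm (f x) * norm (g x)"
      by simp
    ultimately show ?thesis
      using Cauchy_Schwarz_ineq2[of "f x" "g x"] by linarith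
  qed
  show ?thesis
    unfolding set_integrable_def
  proof (rule Bochner_Integration.integrable_bound[OF sq])
    show "(\<lambda>x. indicat_real \<Omega> x *\<^sub>R (f x \<bullet> g x)) \<in> borel_measurable lebesgue"
      unfolding prod using meas by (rule borel_measurable_inner)
    show "AE x in lebesgue. norm (indicat_real \<Omega> x *\<^sub>R (f x \<bullet> g x)) \<le>
        norm (indicat_real \<Omega> x *\<^sub>R (norm (f x))\<^sup>2 + indicat_real \<Omega> x *\<^sub>R (norm (g x))\<^sup>2)"
      using young by (auto simp: indicator_def)
  qed
qed

lemma half_norm_sq_AE_zero:
  assumes "AE x in surface_measure \<Gamma>. g x = 0"
  shows "half_norm_sq \<Gamma> g = 0"
proof -
  have "(\<integral>\<^sup>+x. ennreal ((g x)\<^sup>2) \<partial>surface_measure \<Gamma>) = (\<integral>\<^sup>+x. 0 \<partial>surface_measure \<Gamma>)"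
    by (rule nn_integral_cong_AE) (use assms in \<open>eventually_elim, simp\<close>)
  moreover have "(\<integral>\<^sup>+y. ennreal ((g x - g y)\<^sup>2 / dist x y ^ 3) \<partial>surface_measure \<Gamma>) = 0"
    if "g x = 0" for x
  proof -
    have "(\<integral>\<^sup>+y. ennreal ((g x - g y)\<^sup>2 / dist x y ^ 3) \<partial>surface_measure \<Gamma>) =
        (\<integral>\<^sup>+y. 0 \<partial>surface_measure \<Gamma>)"
      by (rule nn_integral_cong_AE) (use assms in \<open>eventually_elim, simp add: that\<close>)
    then show ?thesis by simp
  qed
  then have "(\<integral>\<^sup>+x. (\<integral>\<^sup>+y. ennreal ((g x - g y)\<^sup>2 / dist x y ^ 3) \<partial>surface_measure \<Gamma>)
      \<partial>surface_measure \<Gamma>) = (\<integral>\<^sup>+x. 0 \<partial>surface_measure \<Gamma>)"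
    by (intro nn_integral_cong_AE) (use assms in \<open>eventually_elim, simp\<close>)
  ultimately show ?thesis
    by (simp add: half_norm_sq_def)
qed

lemma W_half_uminus:
  assumes "g \<in> W_half \<Gamma>"
  shows "(\<lambda>x. - 1 * g x) \<in> W_half \<Gamma>"
proof -
  have "(- 1 * a - - 1 * b)\<^sup>2 = (a - b)\<^sup>2" for a b :: real
    by (simp add: power2_commute)
  then have "half_norm_sq \<Gamma> (\<lambda>x. - 1 * g x) = half_norm_sq \<Gamma> g"
    unfolding half_norm_sq_def by simp
  then show ?thesis
    using assms by (auto simp: W_half_def)
qed

text \<open>The difference of two functions that are equal almost everywhere has norm zero, so a bounded
  linear functional vanishes on it.\<close>

lemma W_half_dual_cong_AE:
  assumes f: "f \<in> W_half_dual \<Gamma>" and g: "g \<in> W_half \<Gamma>" and h: "h \<in> W_half \<Gamma>"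
    and eq: "AE x in surface_measure \<Gamma>. g x = h x"
  shows "f g = f h"
proof -
  let ?d = "\<lambda>x. g x + - 1 * h x"
  have zero: "half_norm_sq \<Gamma> ?d = 0"
    by (rule half_norm_sq_AE_zero) (use eq in \<open>eventually_elim, simp\<close>)
  have "?d \<in> borel_measurable (surface_measure \<Gamma>)"
    using g h by (auto simp: W_half_def)
  with zero have d: "?d \<in> W_half \<Gamma>"
    by (simp add: W_half_def)
  obtain B where "\<forall>k \<in> W_half \<Gamma>. \<bar>f k\<bar> \<le> B * sqrt (enn2real (half_norm_sq \<Gamma> k))"
    using f unfolding W_half_dual_def by blast
  from bspec[OF this d] have "f ?d = 0"
    using zero by simp
  moreover have "f ?d = f g + f (\<lambda>x. - 1 * h x)"
    using f g W_half_uminus[OF h] by (simp only: W_half_dual_def mem_Collect_eq)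
  moreover have "f (\<lambda>x. - 1 * h x) = - 1 * f h"
    using f h by (simp only: W_half_dual_def mem_Collect_eq)
  ultimately show ?thesis by simp
qed

lemma dirichlet_product_split:
  assumes "open G" "u \<in> H1 G" "v \<in> H1 G"
  shows "dirichlet_product G u v =
     (LINT x:G|lebesgue. weak_grad G (fst u) x \<bullet> weak_grad G (fst v) x) +
     (LINT x:exterior G|lebesgue.
        weak_grad (exterior G) (snd u) x \<bullet> weak_grad (exterior G) (snd v) x)"
proof -
  let ?E = "exterior G"
  have disj: "G \<inter> ?E = {}"
    using closure_subset[of G] by (auto simp: exterior_def)
  have sets: "G \<in> sets lebesgue" "?E \<in> sets lebesgue"
    using \<open>open G\<close> by (auto simp: exterior_def open_Compl intro: lebesgue_openin)
  have grad_in: "grad G u x \<bullet> grad G v x = weak_grad G (fst u) x \<bullet> weak_grad G (fst v) x"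
    if "x \<in> G" for x
    using that by (simp add: grad_def)
  have grad_out: "grad G u x \<bullet> grad G v x = weak_grad ?E (snd u) x \<bullet> weak_grad ?E (snd v) x"
    if "x \<in> ?E" for x
    using that disj by (auto simp: grad_def)
  have "set_integrable lebesgue G (\<lambda>x. grad G u x \<bullet> grad G v x)"
    using L2_inner_set_integrable[of "weak_grad G (fst u)" G "weak_grad G (fst v)"] assms(2,3)
    by (subst set_integrable_cong[OF refl refl grad_in]) (auto simp: H1_def W21_def)
  moreover have "set_integrable lebesgue ?E (\<lambda>x. grad G u x \<bullet> grad G v x)"
    using L2_inner_set_integrable[of "weak_grad ?E (snd u)" ?E "weak_grad ?E (snd v)"] assms(2,3)
    by (subst set_integrable_cong[OF refl refl grad_out]) (auto simp: H1_def W210_def)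
  ultimately have "dirichlet_product G u v =
      (LINT x:G|lebesgue. grad G u x \<bullet> grad G v x) + (LINT x:?E|lebesgue. grad G u x \<bullet> grad G v x)"
    unfolding dirichlet_product_def by (rule set_integral_Un[OF disj])
  also have "(LINT x:G|lebesgue. grad G u x \<bullet> grad G v x) =
      (LINT x:G|lebesgue. weak_grad G (fst u) x \<bullet> weak_grad G (fst v) x)"
    by (intro set_lebesgue_integral_cong sets) (simp add: grad_in)
  also have "(LINT x:?E|lebesgue. grad G u x \<bullet> grad G v x) =
      (LINT x:?E|lebesgue. weak_grad ?E (snd u) x \<bullet> weak_grad ?E (snd v) x)"
    by (intro set_lebesgue_integral_cong sets) (simp add: grad_out)
  finally show ?thesis .
qed

lemma dirichlet_product_zero_jumps:
  assumes "open G" and u: "u \<in> H1_Gamma_harmonic G" and v: "v \<in> zero_normal_jump G"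
  shows "dirichlet_product G u v = 0"
proof -
  let ?E = "exterior G"
  have H1: "u \<in> H1 G" "v \<in> H1 G"
    using u v by (auto simp: H1_Gamma_harmonic_def zero_normal_jump_def H1_harmonic_def)
  obtain g h where g: "has_trace_i G (fst u) g" and h: "has_trace_e G (snd u) h"
    and "AE x in surface_measure (frontier G). 0 = g x - h x"
    using u by (auto simp: H1_Gamma_harmonic_def has_trace_jump_def)
  from this(3) have gh: "AE x in surface_measure (frontier G). g x = h x"
    by eventually_elim simp
  obtain fi fe where fi: "has_normal_deriv_i G (fst v) fi" and fe: "has_normal_deriv_e G (snd v) fe"
    and "\<forall>k \<in> W_half (frontier G). 0 = fi k - fe k"
    using v by (auto simp: zero_normal_jump_def has_normal_jump_def)
  then have fi_fe: "fi k = fe k" if "k \<in> W_half (frontier G)" for k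
    using that by simp
  have W: "g \<in> W_half (frontier G)" "h \<in> W_half (frontier G)"
    using g h by (auto simp: has_trace_i_def has_trace_e_def)
  have "(LINT x:G|lebesgue. weak_grad G (fst v) x \<bullet> weak_grad G (fst u) x) = fi g"
    using fi g H1(1) by (auto simp: has_normal_deriv_i_def H1_def)
  moreover have "(LINT x:?E|lebesgue. weak_grad ?E (snd v) x \<bullet> weak_grad ?E (snd u) x) = - fe h"
    using fe h H1(1) by (auto simp: has_normal_deriv_e_def H1_def)
  moreover have "fi g = fi h"
    using fi by (intro W_half_dual_cong_AE[OF _ W gh]) (simp add: has_normal_deriv_i_def)
  ultimately show ?thesis
    using fi_fe[OF W(2)] by (simp add: dirichlet_product_split[OF \<open>open G\<close> H1] inner_commute)
qed

theorem mainTheorem1: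
  fixes G :: "(real ^ 3) set"
  assumes "open G" and "bounded G" and "lipschitz_boundary G"
  shows "\<forall>u \<in> H1_Gamma_harmonic G. \<forall>V \<in> K1_Gamma_harmonic G. \<forall>v \<in> V. dirichlet_product G u v = 0"
proof (intro ballI)
  fix u V v
  assume u: "u \<in> H1_Gamma_harmonic G" and "V \<in> K1_Gamma_harmonic G" "v \<in> V"
  then have "v \<in> zero_normal_jump G"
    by (auto simp: K1_Gamma_harmonic_def quotient_def mod_R_def)
  with \<open>open G\<close> u show "dirichlet_product G u v = 0"
    by (rule dirichlet_product_zero_jumps)
qed

end
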